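(* Let $x,y\in\mathbb{R}[X]$ with $\deg x\le 1$ and $\deg y\le 1$, and let $\gamma\in\mathbb{R}[X]$ be a polynomial without real roots such that $p=x/\gamma$ and $q=y/\gamma$ lie in $D$. Then $\begin{pmatrix} p & q\\ 0 & 0\end{pmatrix}$ is a product of idempotent $2\times 2$ matrices over $D$.
   Context: $D$ denotes the minimal Dress ring of the field $\mathbb{R}(X)$, i.e. the subring of $\mathbb{R}(X)$ generated by $\mathbb{Z}$ and all elements $1/(1+h^2)$ with $h\in\mathbb{R}(X)$. A matrix $E$ is idempotent if $E^2=E$. *)

theory Defs
  imports "HOL-Analysis.Analysis" "HOL-Computational_Algebra.Polynomial" "HOL-Computational_Algebra.Fraction_Field"
begin

text \<open>The field R(X) of real rational functions is modelled as the fraction field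
  of real polynomials; a polynomial f is embedded as Fract f 1.\<close>

type_synonym ratfun = "real poly fract"

definition poly_to_ratfun :: "real poly \<Rightarrow> ratfun" where
  "poly_to_ratfun f = Fract f 1"

text \<open>Minimal Dress ring: the subring of R(X) generated by the integers and
  all elements 1/(1+h^2).\<close>
inductive_set dress_ring :: "ratfun set" where
  int: "of_int k \<in> dress_ring"
| gen: "inverse (1 + h^2) \<in> dress_ring"
| add: "a \<in> dress_ring \<Longrightarrow> b \<in> dress_ring \<Longrightarrow> a + b \<in> dress_ring"
| neg: "a \<in> dress_ring \<Longrightarrow> - a \<in> dress_ring"
| mult: "a \<in> dress_ring \<Longrightarrow> b \<in> dress_ring \<Longrightarrow> a * b \<in> dress_ring"

definition mat_over :: "'a set \<Rightarrow> 'a ^ 2 ^ 2 \<Rightarrow> bool" where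
  "mat_over S A \<longleftrightarrow> (\<forall>i j. A $ i $ j \<in> S)"

definition idempotent_mat :: "'a::semiring_1 ^ 'n ^ 'n \<Rightarrow> bool" where
  "idempotent_mat E \<longleftrightarrow> E ** E = E"

text \<open>A is a product of idempotent 2x2 matrices with entries in S.\<close>
definition prod_of_idempotents_over :: "'a::semiring_1 set \<Rightarrow> 'a ^ 2 ^ 2 \<Rightarrow> bool" where
  "prod_of_idempotents_over S A \<longleftrightarrow>
     (\<exists>Es. Es \<noteq> [] \<and> (\<forall>E \<in> set Es. mat_over S E \<and> idempotent_mat E)
           \<and> A = foldr (**) Es (mat 1))"

end

theory Submission
  imports Defs "HOL-Computational_Algebra.Fundamental_Theorem_Algebra"
begin

text \<open>
  Every real polynomial without real roots is a product of a constant and factors \<open>1 + u\<^sup>2\<close>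
  with \<open>u\<close> linear, and \<open>v / (1 + u\<^sup>2)\<close> lies in \<open>D\<close> for \<open>deg v \<le> 1\<close>; by induction, \<open>f / g \<in> D\<close>
  whenever \<open>g\<close> has no real roots and \<open>deg f \<le> deg g\<close>. Conversely every element of \<open>D\<close> is
  some \<open>f / g\<close> with \<open>deg f \<le> deg g\<close>, so the hypotheses amount to \<open>deg x, deg y \<le> deg \<gamma>\<close>.

  If \<open>x\<close> and \<open>y\<close> are linearly dependent over \<open>\<real>\<close>, the row \<open>(p, q)\<close> is a constant multiple of one
  of its entries and factors through two idempotents. Otherwise pick \<open>r\<close> with \<open>y(r) \<noteq> 0\<close> and put
  \<open>a = x(r)/\<gamma>(r)\<close>, \<open>c = y(r)/\<gamma>(r)\<close>. Let \<open>m\<close> solve \<open>x m\<^sub>1 + y m\<^sub>2 = 1\<close>, \<open>a m\<^sub>1 + c m\<^sub>2 = 1/\<gamma>\<close>.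
  The determinant \<open>c x - a y\<close> of this system is a nonzero multiple of \<open>X - r\<close>, and both
  numerators vanish at \<open>r\<close>, so \<open>m = (Q\<^sub>1, Q\<^sub>2) / (k \<gamma>)\<close> with \<open>deg Q\<^sub>i < deg \<gamma>\<close>. Hence the
  rank-one idempotent \<open>m (x, y)\<close> has entries in \<open>D\<close>, and
  \<open>(p q; 0 0) = E\<^sub>1\<^sub>1 \<cdot> (a c; a(1-a)/c 1-a) \<cdot> m (x, y)\<close>.
\<close>

locale comm_subring =
  fixes S :: "'a::comm_ring_1 set"
  assumes zero_mem: "0 \<in> S" and one_mem: "1 \<in> S"
    and add_mem: "a \<in> S \<Longrightarrow> b \<in> S \<Longrightarrow> a + b \<in> S"
    and uminus_mem: "a \<in> S \<Longrightarrow> - a \<in> S"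
    and mult_mem: "a \<in> S \<Longrightarrow> b \<in> S \<Longrightarrow> a * b \<in> S"
begin

lemma diff_mem: "a \<in> S \<Longrightarrow> b \<in> S \<Longrightarrow> a - b \<in> S"
  using add_mem[of a "- b"] uminus_mem[of b] by simp

end

definition mat2 :: "'a::zero \<Rightarrow> 'a \<Rightarrow> 'a \<Rightarrow> 'a \<Rightarrow> 'a ^ 2 ^ 2" where
  "mat2 a b c d = vector [vector [a, b], vector [c, d]]"

lemma mat2_eq_iff: "mat2 a b c d = mat2 a' b' c' d' \<longleftrightarrow> a = a' \<and> b = b' \<and> c = c' \<and> d = d'"
  by (auto simp: mat2_def vec_eq_iff forall_2)

lemma mat2_mult:
  "mat2 a b c d ** mat2 e f g h = mat2 (a*e + b*g) (a*f + b*h) (c*e + d*g) (c*f + d*h)"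
  by (simp add: mat2_def vec_eq_iff forall_2 matrix_matrix_mult_def sum_2)

lemma mat_1_eq_mat2: "(mat 1 :: 'a::semiring_1 ^ 2 ^ 2) = mat2 1 0 0 1"
  by (simp add: mat2_def vec_eq_iff forall_2 mat_def)

lemma mat_over_mat2: "mat_over S (mat2 a b c d) \<longleftrightarrow> a \<in> S \<and> b \<in> S \<and> c \<in> S \<and> d \<in> S"
  by (simp add: mat_over_def mat2_def forall_2)

lemma idempotent_mat_outer_product:
  fixes m1 m2 w1 w2 :: "'a::comm_ring_1"
  assumes "w1 * m1 + w2 * m2 = 1"
  shows "idempotent_mat (mat2 (m1 * w1) (m1 * w2) (m2 * w1) (m2 * w2))"
proof -
  have entry: "u * w1 * (m1 * v) + u * w2 * (m2 * v) = u * v" for u v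
  proof -
    have "u * w1 * (m1 * v) + u * w2 * (m2 * v) = u * v * (w1 * m1 + w2 * m2)"
      by (simp add: algebra_simps)
    then show ?thesis using assms by simp
  qed
  show ?thesis by (simp add: idempotent_mat_def mat2_mult mat2_eq_iff entry)
qed

context comm_subring
begin

lemma prod_of_idempotents_row_multiple_left:
  assumes "p \<in> S" "L \<in> S"
  shows "prod_of_idempotents_over S (mat2 p (L * p) 0 0)"
proof -
  define E1 where "E1 = mat2 (1 * 1) (1 * (p - 1 + L)) (0 * 1) (0 * (p - 1 + L))"
  define E2 where "E2 = mat2 ((1 - L) * 1) ((1 - L) * L) (1 * 1) (1 * L)"
  have "idempotent_mat E1" "idempotent_mat E2"
    unfolding E1_def E2_def by (intro idempotent_mat_outer_product; simp)+
  moreover have "mat_over S E1" "mat_over S E2"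
    unfolding E1_def E2_def mat_over_mat2
    using assms zero_mem one_mem by (auto intro!: add_mem diff_mem mult_mem)
  moreover have "mat2 p (L * p) 0 0 = foldr (**) [E1, E2] (mat 1)"
    by (simp add: E1_def E2_def mat_1_eq_mat2 mat2_mult mat2_eq_iff algebra_simps)
  ultimately show ?thesis
    unfolding prod_of_idempotents_over_def by (intro exI[of _ "[E1, E2]"]) auto
qed

lemma prod_of_idempotents_row_multiple_right:
  assumes "q \<in> S" "L \<in> S"
  shows "prod_of_idempotents_over S (mat2 (L * q) q 0 0)"
proof -
  define E1 where "E1 = mat2 (1 * 1) (1 * q) (0 * 1) (0 * q)"
  define E2 where "E2 = mat2 (0 * L) (0 * 1) (1 * L) (1 * 1)"
  have "idempotent_mat E1" "idempotent_mat E2"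
    unfolding E1_def E2_def by (intro idempotent_mat_outer_product; simp)+
  moreover have "mat_over S E1" "mat_over S E2"
    unfolding E1_def E2_def mat_over_mat2 using assms zero_mem one_mem by auto
  moreover have "mat2 (L * q) q 0 0 = foldr (**) [E1, E2] (mat 1)"
    by (simp add: E1_def E2_def mat_1_eq_mat2 mat2_mult mat2_eq_iff algebra_simps)
  ultimately show ?thesis
    unfolding prod_of_idempotents_over_def by (intro exI[of _ "[E1, E2]"]) auto
qed

lemma prod_of_idempotents_row_factor:
  assumes wm: "w1 * m1 + w2 * m2 = 1"
    and "m1 * w1 \<in> S" "m1 * w2 \<in> S" "m2 * w1 \<in> S" "m2 * w2 \<in> S"
    and "a \<in> S" "c \<in> S" "c' \<in> S" and cc': "c * c' = 1"
  shows "prod_of_idempotents_over S (mat2 ((a * m1 + c * m2) * w1) ((a * m1 + c * m2) * w2) 0 0)"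
proof -
  define E1 :: "'a ^ 2 ^ 2" where "E1 = mat2 (1 * 1) (1 * 0) (0 * 1) (0 * 0)"
  define G where "G = mat2 a c ((1 - a) * (a * c')) (1 - a)"
  define E where "E = mat2 (m1 * w1) (m1 * w2) (m2 * w1) (m2 * w2)"
  have "G = mat2 (c * (a * c')) (c * 1) ((1 - a) * (a * c')) ((1 - a) * 1)"
    using cc' by (simp add: G_def mat2_eq_iff mult.left_commute[of c])
  then have "idempotent_mat G"
    using idempotent_mat_outer_product[of "a * c'" c 1 "1 - a"] cc'
    by (simp add: algebra_simps)
  moreover have "idempotent_mat E1" "idempotent_mat E"
    unfolding E1_def E_def using wm by (intro idempotent_mat_outer_product; simp)+
  moreover have "mat_over S E1" "mat_over S G" "mat_over S E"
    unfolding E1_def G_def E_def mat_over_mat2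
    using assms zero_mem one_mem by (auto intro!: diff_mem mult_mem)
  moreover have "mat2 ((a * m1 + c * m2) * w1) ((a * m1 + c * m2) * w2) 0 0
      = foldr (**) [E1, G, E] (mat 1)"
    by (simp add: E1_def G_def E_def mat_1_eq_mat2 mat2_mult mat2_eq_iff algebra_simps)
  ultimately show ?thesis
    unfolding prod_of_idempotents_over_def by (intro exI[of _ "[E1, G, E]"]) auto
qed

end

interpretation dress_ring: comm_subring dress_ring
proof
  show "0 \<in> dress_ring" using dress_ring.int[of 0] by simp
  show "1 \<in> dress_ring" using dress_ring.int[of 1] by simp
qed (fact dress_ring.add dress_ring.neg dress_ring.mult)+

lemma Fract_add_same_denom: "b \<noteq> 0 \<Longrightarrow> Fract a b + Fract c b = Fract (a + c) b"
  by (simp add: eq_fract algebra_simps)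

definition ratfun_of_real :: "real \<Rightarrow> ratfun" where
  "ratfun_of_real c = Fract [:c:] 1"

lemma ratfun_of_real_add: "ratfun_of_real (a + b) = ratfun_of_real a + ratfun_of_real b"
  by (simp add: ratfun_of_real_def)

lemma ratfun_of_real_mult: "ratfun_of_real (a * b) = ratfun_of_real a * ratfun_of_real b"
  by (simp add: ratfun_of_real_def mult.commute)

lemma ratfun_of_real_diff: "ratfun_of_real (a - b) = ratfun_of_real a - ratfun_of_real b"
  by (simp add: ratfun_of_real_def)

lemma ratfun_of_real_of_nat: "ratfun_of_real (of_nat n) = of_nat n"
  by (simp add: ratfun_of_real_def of_nat_fract of_nat_poly)

lemma ratfun_of_real_1: "ratfun_of_real 1 = 1"
  by (simp add: ratfun_of_real_def One_fract_def one_pCons)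

lemma ratfun_of_real_inverse: "ratfun_of_real (inverse a) = inverse (ratfun_of_real a)"
  by (cases "a = 0") (auto simp: ratfun_of_real_def eq_fract fract_collapse)

lemma ratfun_of_real_mult_Fract: "ratfun_of_real c * Fract f g = Fract (smult c f) g"
  by (simp add: ratfun_of_real_def)

lemma ratfun_of_real_in_dress_ring: "ratfun_of_real c \<in> dress_ring"
proof -
  obtain n :: nat where n: "\<bar>c\<bar> < real n"
    using reals_Archimedean2 by blast
  \<comment> \<open>\<open>c = 2n / (1 + t\<^sup>2) - n\<close>, which is possible as \<open>(c + n) / 2n \<in> (0, 1]\<close>\<close>
  define t where "t = sqrt (2 * n / (c + n) - 1)"
  have "1 + t\<^sup>2 = 2 * n / (c + n)"
    unfolding t_def using n by (simp add: field_simps)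
  then have "inverse (1 + t\<^sup>2) = (c + n) / (2 * n)"
    by simp
  then have "inverse (1 + ratfun_of_real t ^ 2) = ratfun_of_real ((c + n) / (2 * n))"
    by (simp add: power2_eq_square flip: ratfun_of_real_1
        ratfun_of_real_mult ratfun_of_real_add ratfun_of_real_inverse)
  moreover have "c = real (2 * n) * ((c + n) / (2 * n)) - real n"
    using n by simp
  then have "ratfun_of_real c
      = of_int (int (2 * n)) * ratfun_of_real ((c + n) / (2 * n)) - of_int (int n)"
    by (metis of_int_of_nat_eq ratfun_of_real_diff ratfun_of_real_mult ratfun_of_real_of_nat)
  ultimately show ?thesis
    by (metis dress_ring.diff_mem dress_ring.gen dress_ring.int dress_ring.mult)
qed

lemma Fract_over_one_plus_square_in_dress_ring:
  fixes s t :: real and v :: "real poly"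
  assumes t: "t \<noteq> 0" and v: "degree v \<le> 1"
  shows "Fract v (1 + [:s, t:]\<^sup>2) \<in> dress_ring"
proof -
  define u where "u = [:s, t:]"
  define U where "U = Fract u 1"
  have "poly (1 + u\<^sup>2) 0 > 0"
    by (simp add: add_pos_nonneg)
  then have W0: "1 + u\<^sup>2 \<noteq> 0"
    by (metis less_irrefl poly_0)
  moreover have "1 + U\<^sup>2 = Fract (1 + u\<^sup>2) 1"
    by (simp add: U_def power2_eq_square One_fract_def)
  ultimately have "1 + U\<^sup>2 \<noteq> 0"
    by (auto simp: Zero_fract_def eq_fract)
  have "U + 1 \<noteq> 0"
    using t by (auto simp: U_def u_def One_fract_def Zero_fract_def eq_fract one_pCons)
  have "Fract 1 (1 + u\<^sup>2) = inverse (1 + U\<^sup>2)"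
    by (simp add: U_def power2_eq_square One_fract_def)
  then have "Fract 1 (1 + u\<^sup>2) \<in> dress_ring"
    by (simp add: dress_ring.gen)
  moreover have "Fract u (1 + u\<^sup>2) \<in> dress_ring"
  proof -
    have "Fract u (1 + u\<^sup>2) = U / (1 + U\<^sup>2)"
      by (simp add: U_def power2_eq_square One_fract_def)
    \<comment> \<open>for \<open>h = (U - 1) / (U + 1)\<close> one has \<open>1 + h\<^sup>2 = 2 (1 + U\<^sup>2) / (U + 1)\<^sup>2\<close>\<close>
    also have "\<dots> = inverse (1 + ((U - 1) / (U + 1))\<^sup>2) - inverse (1 + 1\<^sup>2)"
      using \<open>1 + U\<^sup>2 \<noteq> 0\<close> \<open>U + 1 \<noteq> 0\<close>
      by (simp add: divide_simps power2_eq_square) (simp add: algebra_simps)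
    finally show ?thesis
      by (metis dress_ring.diff_mem dress_ring.gen)
  qed
  moreover have v_eq: "smult (coeff v 0 - coeff v 1 * s / t) 1 + smult (coeff v 1 / t) u = v"
    using v t by (auto simp: u_def poly_eq_iff coeff_pCons coeff_eq_0 field_simps split: nat.split)
  then have "Fract v (1 + u\<^sup>2)
      = ratfun_of_real (coeff v 0 - coeff v 1 * s / t) * Fract 1 (1 + u\<^sup>2)
        + ratfun_of_real (coeff v 1 / t) * Fract u (1 + u\<^sup>2)"
    unfolding ratfun_of_real_mult_Fract Fract_add_same_denom[OF W0] by (simp only: v_eq)
  ultimately show ?thesis
    unfolding u_def by (metis dress_ring.add_mem dress_ring.mult_mem ratfun_of_real_in_dress_ring)
qed

lemma map_poly_of_real_add:
  "map_poly of_real (p + q) = (map_poly of_real p + map_poly of_real q :: 'a::real_algebra_1 poly)"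
  by (simp add: poly_eq_iff coeff_map_poly)

lemma map_poly_of_real_mult:
  "map_poly of_real (p * q)
    = (map_poly of_real p * map_poly of_real q :: 'a::{real_algebra_1, comm_ring_1} poly)"
proof (induction p)
  case (pCons a p)
  have "map_poly of_real (smult a q) = (smult (of_real a) (map_poly of_real q) :: 'a poly)"
    by (intro poly_eqI) (simp add: coeff_map_poly)
  then show ?case
    using pCons.IH by (simp add: map_poly_of_real_add map_poly_pCons)
qed simp

lemma poly_map_poly_of_real:
  "poly (map_poly of_real p) (of_real x) = (of_real (poly p x) :: 'a::{real_algebra_1, comm_ring_1})"
  by (induction p) (auto simp: map_poly_pCons)

lemma linear_poly_eq: "degree (v :: 'a::zero poly) \<le> 1 \<Longrightarrow> v = [:coeff v 0, coeff v 1:]"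
  by (auto simp: poly_eq_iff coeff_pCons coeff_eq_0 split: nat.split)

lemma root_free_real_poly_has_sum_of_squares_factor:
  fixes g :: "real poly"
  assumes no_root: "\<forall>x. poly g x \<noteq> 0" and "degree g > 0"
  obtains s t g' where "t \<noteq> 0" "g = (1 + [:s, t:]\<^sup>2) * g'"
proof -
  let ?C = "map_poly complex_of_real"
  have "degree (?C g) > 0"
    using \<open>degree g > 0\<close> by (simp add: degree_map_poly)
  then obtain z where z: "poly (?C g) z = 0"
    using alg_closed_imp_poly_has_root by blast
  define a where "a = Re z"
  define b where "b = Im z"
  have "b \<noteq> 0"
  proof
    assume "b = 0"
    then have "z = of_real a"
      by (simp add: a_def b_def complex_eq_iff)
    then show False
      using z no_root by (simp add: poly_map_poly_of_real)
  qed
  \<comment> \<open>\<open>Q = (X - z) (X - cnj z)\<close> divides \<open>g\<close>: the remainder is linear and vanishes at non-real \<open>z\<close>\<close>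
  define Q where "Q = [:a\<^sup>2 + b\<^sup>2, -2 * a, 1:]"
  have "Q \<noteq> 0" "degree Q = 2"
    by (simp_all add: Q_def)
  have "poly (?C Q) z = 0"
    by (simp add: Q_def map_poly_pCons complex_eq_iff a_def b_def algebra_simps power2_eq_square)
  define r where "r = g mod Q"
  have "g = g div Q * Q + r"
    by (simp add: r_def)
  then have "poly (?C r) z = 0"
    using z \<open>poly (?C Q) z = 0\<close>
    by (metis add_0 mult_zero_right poly_add poly_mult map_poly_of_real_add map_poly_of_real_mult)
  moreover have r_eq: "r = [:coeff r 0, coeff r 1:]"
    using degree_mod_less[OF \<open>Q \<noteq> 0\<close>, of g] \<open>degree Q = 2\<close>
    by (intro linear_poly_eq) (auto simp: r_def)
  ultimately have "of_real (coeff r 0) + of_real (coeff r 1) * z = 0"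
    by (subst (asm) r_eq) (simp add: map_poly_pCons mult.commute)
  then have "coeff r 0 + coeff r 1 * a = 0" "coeff r 1 * b = 0"
    by (simp_all add: complex_eq_iff a_def b_def)
  then have "r = 0"
    using \<open>b \<noteq> 0\<close> r_eq by simp
  moreover have "Q = (1 + [:- a / b, 1 / b:]\<^sup>2) * [:b\<^sup>2:]"
    using \<open>b \<noteq> 0\<close>
    by (simp add: Q_def poly_eq_iff coeff_pCons power2_eq_square field_simps split: nat.split)
  ultimately have g_eq: "g = (1 + [:- a / b, 1 / b:]\<^sup>2) * ([:b\<^sup>2:] * (g div Q))"
    by (metis \<open>g = g div Q * Q + r\<close> add_0_right mult.assoc mult.commute)
  show ?thesis
    using \<open>b \<noteq> 0\<close> by (intro that[OF _ g_eq]) simp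
qed

lemma degree_one_plus_square: "(t :: real) \<noteq> 0 \<Longrightarrow> degree (1 + [:s, t:]\<^sup>2) = 2"
  by (subst degree_add_eq_right) (simp_all add: power2_eq_square degree_mult_eq)

lemma Fract_in_dress_ring:
  fixes f g :: "real poly"
  assumes "\<forall>x. poly g x \<noteq> 0" and "degree f \<le> degree g"
  shows "Fract f g \<in> dress_ring"
  using assms
proof (induction "degree g" arbitrary: f g rule: less_induct)
  case less
  show ?case
  proof (cases "degree g = 0")
    case True
    then obtain c where "g = [:c:]"
      using degree0_coeffs by blast
    with less.prems(1) have "c \<noteq> 0"
      by auto
    moreover obtain d where "f = [:d:]"
      using True less.prems(2) degree0_coeffs[of f] by auto
    ultimately have "Fract f g = ratfun_of_real (d / c)"
      using \<open>g = [:c:]\<close>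
      by (simp add: ratfun_of_real_def eq_fract)
    then show ?thesis
      by (simp add: ratfun_of_real_in_dress_ring)
  next
    case False
    then have "degree g > 0"
      by simp
    with less.prems(1) obtain s t g' where "t \<noteq> 0" and g: "g = (1 + [:s, t:]\<^sup>2) * g'"
      by (rule root_free_real_poly_has_sum_of_squares_factor)
    define W where "W = 1 + [:s, t:]\<^sup>2"
    have "degree W = 2"
      using \<open>t \<noteq> 0\<close> by (simp add: W_def degree_one_plus_square)
    then have "W \<noteq> 0"
      by auto
    have "g' \<noteq> 0" "\<forall>x. poly g' x \<noteq> 0"
      using less.prems(1) by (auto simp: g)
    then have deg_g: "degree g = 2 + degree g'"
      using \<open>W \<noteq> 0\<close> \<open>degree W = 2\<close> by (simp add: g W_def [symmetric] degree_mult_eq)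
    define S R where "S = f div W" and "R = f mod W"
    have f: "f = S * W + R"
      by (simp add: S_def R_def)
    have "degree R \<le> 1"
      using degree_mod_less[OF \<open>W \<noteq> 0\<close>, of f] \<open>degree W = 2\<close> by (auto simp: R_def)
    have "degree S \<le> degree g'"
    proof (cases "S = 0")
      case False
      then have "degree f = degree S + 2"
        using \<open>W \<noteq> 0\<close> \<open>degree W = 2\<close> \<open>degree R \<le> 1\<close>
        by (subst f, subst degree_add_eq_left) (simp_all add: degree_mult_eq)
      then show ?thesis
        using less.prems(2) deg_g by simp
    qed simp
    have "Fract S g' + Fract R W * Fract 1 g' = Fract (S * W + R) (W * g')"
      using \<open>W \<noteq> 0\<close> \<open>g' \<noteq> 0\<close> by (simp add: eq_fract algebra_simps)
    then have "Fract f g = Fract S g' + Fract R W * Fract 1 g'"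
      by (simp add: g W_def f)
    moreover have "Fract h g' \<in> dress_ring" if "degree h \<le> degree g'" for h
      using less.hyps[of g' h] \<open>\<forall>x. poly g' x \<noteq> 0\<close> that deg_g by simp
    moreover have "Fract R W \<in> dress_ring"
      unfolding W_def using \<open>t \<noteq> 0\<close> \<open>degree R \<le> 1\<close>
      by (rule Fract_over_one_plus_square_in_dress_ring)
    ultimately show ?thesis
      using \<open>degree S \<le> degree g'\<close>
      by (metis degree_1 dress_ring.add_mem dress_ring.mult_mem le0)
  qed
qed

definition proper_ratfun :: "ratfun \<Rightarrow> bool" where
  "proper_ratfun r \<longleftrightarrow> (\<exists>f g. g \<noteq> 0 \<and> r = Fract f g \<and> degree f \<le> degree g)"

lemma degree_square_le_sum_of_squares:
  fixes f g :: "real poly"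
  shows "degree (g * g) \<le> degree (g * g + f * f)"
proof (cases "degree f \<le> degree g")
  case True
  show ?thesis
  proof (cases "degree f = degree g")
    case True
    have "coeff (g * g + f * f) (degree g + degree g) = (lead_coeff g)\<^sup>2 + (lead_coeff f)\<^sup>2"
      using True coeff_mult_degree_sum[of f f] coeff_mult_degree_sum[of g g]
      by (simp add: power2_eq_square)
    then show ?thesis
      by (cases "g = 0") (auto simp: degree_mult_eq intro!: le_degree)
  next
    case False
    with True have "degree f < degree g"
      by simp
    then have "g \<noteq> 0"
      by auto
    with \<open>degree f < degree g\<close> have "degree (f * f) < degree (g * g)"
      using degree_mult_le[of f f] by (simp add: degree_mult_eq)
    then show ?thesis
      by (simp add: degree_add_eq_left)
  qed
next
  case False
  then have "f \<noteq> 0"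
    by auto
  with False have "degree (g * g) < degree (f * f)"
    using degree_mult_le[of g g] by (simp add: degree_mult_eq)
  then show ?thesis
    by (simp add: degree_add_eq_right)
qed

lemma sum_of_squares_nonzero:
  fixes f g :: "real poly"
  assumes "g \<noteq> 0"
  shows "g * g + f * f \<noteq> 0"
proof
  obtain x where "poly g x \<noteq> 0"
    using assms poly_all_0_iff_0 by blast
  moreover assume "g * g + f * f = 0"
  then have "poly (g * g + f * f) x = 0"
    by simp
  ultimately show False
    by (simp add: add_pos_nonneg)
qed

lemma of_int_fract: "(of_int k :: 'a::idom fract) = Fract (of_int k) 1"
  by (induction k rule: int_induct[where k = 0]) (simp_all add: One_fract_def Zero_fract_def)

lemma dress_ring_proper: "r \<in> dress_ring \<Longrightarrow> proper_ratfun r"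
proof (induction rule: dress_ring.induct)
  case (int k)
  show ?case
    unfolding proper_ratfun_def
    by (intro exI[of _ "of_int k"] exI[of _ 1]) (simp add: of_int_fract)
next
  case (gen h)
  obtain f g where h: "h = Fract f g" "g \<noteq> 0"
    by (cases h) auto
  have "inverse (1 + h\<^sup>2) = Fract (g * g) (g * g + f * f)"
    using h by (simp add: power2_eq_square One_fract_def algebra_simps)
  then show ?case
    unfolding proper_ratfun_def
    using degree_square_le_sum_of_squares[of g f] sum_of_squares_nonzero[OF h(2), of f] by blast
next
  case (add a b)
  then obtain f1 g1 f2 g2 where a: "g1 \<noteq> 0" "a = Fract f1 g1" "degree f1 \<le> degree g1"
    and b: "g2 \<noteq> 0" "b = Fract f2 g2" "degree f2 \<le> degree g2"
    unfolding proper_ratfun_def by blast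
  have "degree (f1 * g2 + f2 * g1) \<le> degree (g1 * g2)"
    using a b degree_add_le_max[of "f1 * g2" "f2 * g1"]
      degree_mult_le[of f1 g2] degree_mult_le[of f2 g1]
    by (simp add: degree_mult_eq)
  then show ?case
    unfolding proper_ratfun_def using a b
    by (intro exI[of _ "f1 * g2 + f2 * g1"] exI[of _ "g1 * g2"]) simp
next
  case (neg a)
  then show ?case
    unfolding proper_ratfun_def by (metis degree_minus minus_fract)
next
  case (mult a b)
  then obtain f1 g1 f2 g2 where a: "g1 \<noteq> 0" "a = Fract f1 g1" "degree f1 \<le> degree g1"
    and b: "g2 \<noteq> 0" "b = Fract f2 g2" "degree f2 \<le> degree g2"
    unfolding proper_ratfun_def by blast
  have "degree (f1 * f2) \<le> degree (g1 * g2)"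
    using a b degree_mult_le[of f1 f2] by (simp add: degree_mult_eq)
  then show ?case
    unfolding proper_ratfun_def using a b
    by (intro exI[of _ "f1 * f2"] exI[of _ "g1 * g2"]) simp
qed

lemma degree_le_if_Fract_in_dress_ring:
  fixes f g :: "real poly"
  assumes "Fract f g \<in> dress_ring" "g \<noteq> 0"
  shows "degree f \<le> degree g"
proof (cases "f = 0")
  case False
  obtain f' g' where "g' \<noteq> 0" "Fract f g = Fract f' g'" "degree f' \<le> degree g'"
    using dress_ring_proper[OF assms(1)] unfolding proper_ratfun_def by blast
  then have "f * g' = f' * g" "f' \<noteq> 0"
    using assms False by (auto simp: eq_fract)
  then have "degree f + degree g' = degree f' + degree g"
    using assms False \<open>g' \<noteq> 0\<close> by (metis degree_mult_eq)
  then show ?thesis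
    using \<open>degree f' \<le> degree g'\<close> by linarith
qed simp

lemma linear_independent_cofactors:
  fixes x y \<gamma> :: "real poly" and r :: real
  assumes "degree x \<le> 1" "degree y \<le> 1"
    and indep: "\<forall>\<alpha> \<beta>. smult \<alpha> x + smult \<beta> y = 0 \<longrightarrow> \<alpha> = 0 \<and> \<beta> = 0"
    and "poly \<gamma> r \<noteq> 0" "poly y r \<noteq> 0"
  defines "a \<equiv> poly x r / poly \<gamma> r" and "c \<equiv> poly y r / poly \<gamma> r"
  obtains k Q1 Q2
  where "k \<noteq> 0" "x * Q1 + y * Q2 = smult k \<gamma>" "smult a Q1 + smult c Q2 = [:k:]"
    and "smult c \<gamma> - y = [:- r, 1:] * Q1" "x - smult a \<gamma> = [:- r, 1:] * Q2"
proof -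
  define l where "l = smult c x - smult a y"
  have "c \<noteq> 0"
    using assms(4,5) by (simp add: c_def)
  then have "l \<noteq> 0"
    using indep[rule_format, of c "- a"] by (auto simp: l_def)
  have "poly l r = 0"
    using assms(4) by (simp add: l_def a_def c_def field_simps)
  then obtain L where l: "l = [:- r, 1:] * L"
    by (metis dvdE poly_eq_0_iff_dvd)
  have "degree l \<le> 1"
    using assms(1,2) by (simp add: l_def degree_diff_le)
  moreover have "degree l = 1 + degree L"
    using \<open>l \<noteq> 0\<close> unfolding l by (subst degree_mult_eq) auto
  ultimately have "degree L = 0"
    by simp
  then obtain k where "L = [:k:]"
    by (metis degree_eq_zeroE)
  with l \<open>l \<noteq> 0\<close> have "k \<noteq> 0" and l_eq: "l = [:- r, 1:] * [:k:]"
    by auto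
  have "poly (smult c \<gamma> - y) r = 0" "poly (x - smult a \<gamma>) r = 0"
    using assms(4) by (simp_all add: a_def c_def)
  then obtain Q1 Q2 where Q1: "smult c \<gamma> - y = [:- r, 1:] * Q1"
    and Q2: "x - smult a \<gamma> = [:- r, 1:] * Q2"
    by (metis dvdE poly_eq_0_iff_dvd)
  have "[:- r, 1:] \<noteq> 0"
    by simp
  have "[:- r, 1:] * (x * Q1 + y * Q2) = [:- r, 1:] * smult k \<gamma>"
  proof -
    have "[:- r, 1:] * (x * Q1 + y * Q2) = x * (smult c \<gamma> - y) + y * (x - smult a \<gamma>)"
      by (simp add: Q1 Q2 algebra_simps)
    also have "\<dots> = \<gamma> * l"
      by (simp add: l_def algebra_simps)
    finally show ?thesis
      using l_eq by (simp add: algebra_simps)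
  qed
  then have "x * Q1 + y * Q2 = smult k \<gamma>"
    using mult_left_cancel[OF \<open>[:- r, 1:] \<noteq> 0\<close>] by blast
  have "[:- r, 1:] * (smult a Q1 + smult c Q2) = [:- r, 1:] * [:k:]"
  proof -
    have "[:- r, 1:] * (smult a Q1 + smult c Q2)
        = smult a ([:- r, 1:] * Q1) + smult c ([:- r, 1:] * Q2)"
      by (simp only: distrib_left mult_smult_right)
    also have "\<dots> = l"
      by (simp only: flip: Q1 Q2) (simp add: l_def smult_diff_right algebra_simps)
    finally show ?thesis
      using l_eq by simp
  qed
  then have "smult a Q1 + smult c Q2 = [:k:]"
    using mult_left_cancel[OF \<open>[:- r, 1:] \<noteq> 0\<close>] by blast
  with \<open>x * Q1 + y * Q2 = smult k \<gamma>\<close> show ?thesis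
    using that \<open>k \<noteq> 0\<close> Q1 Q2 by blast
qed

lemma degree_cofactor_mult_le:
  assumes "degree ([:- r, 1:] * Q) \<le> n" "degree (z :: real poly) \<le> 1"
  shows "degree (Q * z) \<le> n"
proof (cases "Q = 0")
  case False
  then have "degree ([:- r, 1:] * Q) = 1 + degree Q"
    by (subst degree_mult_eq) auto
  then show ?thesis
    using assms degree_mult_le[of Q z] by linarith
qed simp

lemma smult_dependence_cases:
  fixes x y :: "'a::field poly"
  obtains (left_multiple) L where "x = smult L y"
    | (right_multiple) L where "y = smult L x"
    | (independent) "\<forall>\<alpha> \<beta>. smult \<alpha> x + smult \<beta> y = 0 \<longrightarrow> \<alpha> = 0 \<and> \<beta> = 0"
proof (cases "\<forall>\<alpha> \<beta>. smult \<alpha> x + smult \<beta> y = 0 \<longrightarrow> \<alpha> = 0 \<and> \<beta> = 0")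
  case False
  then obtain \<alpha> \<beta> where lin: "smult \<alpha> x + smult \<beta> y = 0" and "\<alpha> \<noteq> 0 \<or> \<beta> \<noteq> 0"
    by blast
  show ?thesis
  proof (cases "\<alpha> = 0")
    case True
    with lin \<open>\<alpha> \<noteq> 0 \<or> \<beta> \<noteq> 0\<close> have "y = smult 0 x"
      by simp
    then show ?thesis
      by (rule right_multiple)
  next
    case False
    from lin have "smult \<alpha> x = smult (- \<beta>) y"
      by (simp add: eq_neg_iff_add_eq_0)
    then have "x = smult (- \<beta> / \<alpha>) y"
      using False by (metis divide_inverse mult.commute smult_smult smult_1_left right_inverse)
    then show ?thesis
      by (rule left_multiple)
  qed
qed (rule independent)

lemma independent_row_prod_of_idempotents:
  fixes x y \<gamma> :: "real poly"
  assumes "degree x \<le> 1" "degree y \<le> 1"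
    and indep: "\<forall>\<alpha> \<beta>. smult \<alpha> x + smult \<beta> y = 0 \<longrightarrow> \<alpha> = 0 \<and> \<beta> = 0"
    and root_free: "\<forall>t. poly \<gamma> t \<noteq> 0"
    and "degree x \<le> degree \<gamma>" "degree y \<le> degree \<gamma>"
  shows "prod_of_idempotents_over dress_ring (mat2 (Fract x \<gamma>) (Fract y \<gamma>) 0 0)"
proof -
  have "y \<noteq> 0"
    using indep by (metis smult_0_left smult_1_left add_0 zero_neq_one)
  then obtain r where "poly y r \<noteq> 0"
    using poly_all_0_iff_0 by blast
  define a c where "a = poly x r / poly \<gamma> r" and "c = poly y r / poly \<gamma> r"
  obtain k Q1 Q2
    where "k \<noteq> 0" and Q: "x * Q1 + y * Q2 = smult k \<gamma>" "smult a Q1 + smult c Q2 = [:k:]"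
      and Q1: "smult c \<gamma> - y = [:- r, 1:] * Q1" and Q2: "x - smult a \<gamma> = [:- r, 1:] * Q2"
    using linear_independent_cofactors[OF assms(1-3)] root_free \<open>poly y r \<noteq> 0\<close>
    unfolding a_def c_def by metis
  have "c \<noteq> 0"
    using root_free \<open>poly y r \<noteq> 0\<close> by (simp add: c_def)
  define \<gamma>' where "\<gamma>' = smult k \<gamma>"
  have "\<gamma>' \<noteq> 0" "\<forall>t. poly \<gamma>' t \<noteq> 0" "degree \<gamma>' = degree \<gamma>"
    using root_free \<open>k \<noteq> 0\<close> by (auto simp: \<gamma>'_def)
  define m1 m2 w1 w2
    where "m1 = Fract Q1 \<gamma>'" and "m2 = Fract Q2 \<gamma>'" and "w1 = Fract x 1" and "w2 = Fract y 1"
  have "w1 * m1 + w2 * m2 = Fract (x * Q1 + y * Q2) \<gamma>'"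
    unfolding m1_def m2_def w1_def w2_def mult_fract mult_1_left
    using \<open>\<gamma>' \<noteq> 0\<close> by (rule Fract_add_same_denom)
  also have "\<dots> = 1"
    using Q(1) \<open>\<gamma>' \<noteq> 0\<close> by (simp add: \<gamma>'_def One_fract_def eq_fract)
  finally have "w1 * m1 + w2 * m2 = 1" .
  have "ratfun_of_real a * m1 + ratfun_of_real c * m2
      = Fract (smult a Q1 + smult c Q2) \<gamma>'"
    unfolding m1_def m2_def ratfun_of_real_mult_Fract
    using \<open>\<gamma>' \<noteq> 0\<close> by (rule Fract_add_same_denom)
  also have "\<dots> = Fract 1 \<gamma>"
    using Q(2) \<open>\<gamma>' \<noteq> 0\<close> \<open>k \<noteq> 0\<close> by (simp add: \<gamma>'_def eq_fract)
  finally have "ratfun_of_real a * m1 + ratfun_of_real c * m2 = Fract 1 \<gamma>" .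
  then have "Fract x \<gamma> = (ratfun_of_real a * m1 + ratfun_of_real c * m2) * w1"
    "Fract y \<gamma> = (ratfun_of_real a * m1 + ratfun_of_real c * m2) * w2"
    by (simp_all add: w1_def w2_def)
  moreover have "m * w \<in> dress_ring" if "m \<in> {m1, m2}" "w \<in> {w1, w2}" for m w
  proof -
    have "degree (smult c \<gamma> - y) \<le> degree \<gamma>" "degree (x - smult a \<gamma>) \<le> degree \<gamma>"
      using assms(5,6) by (simp_all add: degree_diff_le)
    then have "degree (Q * v) \<le> degree \<gamma>'" if "Q \<in> {Q1, Q2}" "v \<in> {x, y}" for Q v
      using that assms(1,2) Q1 Q2 \<open>degree \<gamma>' = degree \<gamma>\<close> by (auto intro: degree_cofactor_mult_le)
    then show ?thesis
      using that \<open>\<forall>t. poly \<gamma>' t \<noteq> 0\<close>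
      by (auto simp: m1_def m2_def w1_def w2_def intro!: Fract_in_dress_ring)
  qed
  moreover have "ratfun_of_real c * ratfun_of_real (1 / c) = 1"
    using \<open>c \<noteq> 0\<close> by (simp flip: ratfun_of_real_mult ratfun_of_real_1)
  ultimately show ?thesis
    using \<open>w1 * m1 + w2 * m2 = 1\<close>
    by (auto intro!: dress_ring.prod_of_idempotents_row_factor ratfun_of_real_in_dress_ring)
qed

theorem corollary3p4:
  fixes x y \<gamma> :: "real poly" and p q :: ratfun
  assumes "degree x \<le> 1" and "degree y \<le> 1"
    and "\<forall>t::real. poly \<gamma> t \<noteq> 0"
    and "p = poly_to_ratfun x / poly_to_ratfun \<gamma>"
    and "q = poly_to_ratfun y / poly_to_ratfun \<gamma>"
    and "p \<in> dress_ring" and "q \<in> dress_ring"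
  shows "prod_of_idempotents_over dress_ring
           (vector [vector [p, q], vector [0, 0]] :: ratfun ^ 2 ^ 2)"
proof -
  have "\<gamma> \<noteq> 0"
    using assms(3) by auto
  have p: "p = Fract x \<gamma>" and q: "q = Fract y \<gamma>"
    using assms(4,5) by (simp_all add: poly_to_ratfun_def)
  have "degree x \<le> degree \<gamma>" "degree y \<le> degree \<gamma>"
    using assms(6,7) \<open>\<gamma> \<noteq> 0\<close> by (simp_all add: p q degree_le_if_Fract_in_dress_ring)
  show ?thesis
  proof (cases x y rule: smult_dependence_cases)
    case (left_multiple L)
    then have "p = ratfun_of_real L * q"
      by (simp add: p q ratfun_of_real_mult_Fract)
    then show ?thesis
      using dress_ring.prod_of_idempotents_row_multiple_right assms(7) ratfun_of_real_in_dress_ring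
      by (simp add: mat2_def)
  next
    case (right_multiple L)
    then have "q = ratfun_of_real L * p"
      by (simp add: p q ratfun_of_real_mult_Fract)
    then show ?thesis
      using dress_ring.prod_of_idempotents_row_multiple_left assms(6) ratfun_of_real_in_dress_ring
      by (simp add: mat2_def)
  next
    case independent
    then show ?thesis
      using independent_row_prod_of_idempotents assms(1-3)
        \<open>degree x \<le> degree \<gamma>\<close> \<open>degree y \<le> degree \<gamma>\<close>
      by (simp add: p q mat2_def)
  qed
qed

end
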